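(* Let $D\subset\mathbb{R}^2$ be open and let $f,\nu:D\to\mathbb{R}^4\setminus\{0\}$ be smooth with $\langle f,\nu\rangle=0$, related by the projective Lelieuvre map, i.e. $f\wedge f_x=\star(\nu\wedge\nu_x)$ and $f\wedge f_y=-\star(\nu\wedge\nu_y)$ on $D$. Then $$\det|f,f_x,f_y,f_{xy}|=\det|\nu,\nu_x,\nu_y,\nu_{xy}|,$$ $$\det|f,f_x,f_{xx},f_{xxx}|=\det|\nu,\nu_x,\nu_{xx},\nu_{xxx}|,$$ $$\det|f,f_y,f_{yy},f_{yyy}|=\det|\nu,\nu_y,\nu_{yy},\nu_{yyy}|.$$
   Context: $f=(f_1,\dots,f_4)$ and $\nu=(\nu_1,\dots,\nu_4)$ are homogeneous coordinate vectors of surfaces in $P^3$ and in the dual space $P_3$, depending on real variables $(x,y)$; subscripts $x,y$ denote partial derivatives; $\langle f,\nu\rangle=\sum_i f_i\nu_i$. $\varepsilon$ is the totally alternating symbol with $\varepsilon_{1234}=1$. For $a,b\in\mathbb{R}^4$, $(a\wedge b)_{ik}=a_ib_k-a_kb_i$; for a skew-symmetric $T$, $(\star T)_{ik}=\frac12\sum_{l,m}\varepsilon_{lmik}T_{lm}$. Thus the two equations of the map read $f_if_{k,x}-f_kf_{i,x}=\sum_{l,m}\varepsilon_{iklm}\nu_l\nu_{m,x}$ and $f_if_{k,y}-f_kf_{i,y}=-\sum_{l,m}\varepsilon_{iklm}\nu_l\nu_{m,y}$ for $i,k=1,\dots,4$. $\det|a_1,a_2,a_3,a_4|$ is the determinant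 of the matrix formed by the four vectors. *)

theory Defs
  imports "HOL-Analysis.Analysis"
begin

definition partial_x :: "(real \<times> real \<Rightarrow> 'a::real_normed_vector) \<Rightarrow> real \<times> real \<Rightarrow> 'a" where
  "partial_x f p = vector_derivative (\<lambda>t. f (t, snd p)) (at (fst p))"

definition partial_y :: "(real \<times> real \<Rightarrow> 'a::real_normed_vector) \<Rightarrow> real \<times> real \<Rightarrow> 'a" where
  "partial_y f p = vector_derivative (\<lambda>t. f (fst p, t)) (at (snd p))"

text \<open>Class \<open>C\<^sup>n\<close> on an open set \<open>S\<close>. The derivatives are taken with \<open>at x\<close>, not
  \<open>at x within S\<close>, so the notion is only meaningful for open \<open>S\<close>.\<close>

fun C_n_on :: "nat \<Rightarrow> 'a::real_normed_vector set \<Rightarrow> ('a \<Rightarrow> 'b::real_normed_vector) \<Rightarrow> bool" where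
  "C_n_on 0 S f \<longleftrightarrow> continuous_on S f"
| "C_n_on (Suc n) S f \<longleftrightarrow>
     (\<forall>x\<in>S. f differentiable (at x)) \<and>
     (\<forall>v. C_n_on n S (\<lambda>x. frechet_derivative f (at x) v))"

definition smooth_on :: "'a::real_normed_vector set \<Rightarrow> ('a \<Rightarrow> 'b::real_normed_vector) \<Rightarrow> bool" where
  "smooth_on S f \<longleftrightarrow> (\<forall>n. C_n_on n S f)"

text \<open>The index set \<open>{1,2,3,4}\<close> is the type \<open>4\<close>, in which the numeral \<open>4\<close> equals \<open>0\<close>.
  For distinct \<open>i, j, k, l\<close> the symbol is the sign of the permutation
  \<open>1 \<mapsto> i, 2 \<mapsto> j, 3 \<mapsto> k, 4 \<mapsto> l\<close>.\<close>

definition levi_civita :: "4 \<Rightarrow> 4 \<Rightarrow> 4 \<Rightarrow> 4 \<Rightarrow> real" where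
  "levi_civita i j k l =
     (if distinct [i, j, k, l] then of_int (sign (\<lambda>n::4. (vector [i, j, k, l] :: 4^4) $ n)) else 0)"

definition wedge :: "real^4 \<Rightarrow> real^4 \<Rightarrow> real^4^4" where
  "wedge a b = (\<chi> i k. a $ i * b $ k - a $ k * b $ i)"

definition hodge_star :: "real^4^4 \<Rightarrow> real^4^4" where
  "hodge_star T = (\<chi> i k. (1/2) * (\<Sum>l\<in>UNIV. \<Sum>m\<in>UNIV. levi_civita l m i k * T $ l $ m))"

definition projective_lelieuvre_on ::
    "(real \<times> real) set \<Rightarrow> (real \<times> real \<Rightarrow> real^4) \<Rightarrow> (real \<times> real \<Rightarrow> real^4) \<Rightarrow> bool" where
  "projective_lelieuvre_on D f \<nu> \<longleftrightarrow>
     (\<forall>p\<in>D. wedge (f p) (partial_x f p) = hodge_star (wedge (\<nu> p) (partial_x \<nu> p)) \<and>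
            wedge (f p) (partial_y f p) = - hodge_star (wedge (\<nu> p) (partial_y \<nu> p)))"

definition det4 :: "real^4 \<Rightarrow> real^4 \<Rightarrow> real^4 \<Rightarrow> real^4 \<Rightarrow> real" where
  "det4 a b c d = det (vector [a, b, c, d] :: real^4^4)"

lemma vector_4 [simp]:
  "(vector [w, x, y, z] :: 'a::zero^4) $ 1 = w"
  "(vector [w, x, y, z] :: 'a::zero^4) $ 2 = x"
  "(vector [w, x, y, z] :: 'a::zero^4) $ 3 = y"
  "(vector [w, x, y, z] :: 'a::zero^4) $ 4 = z"
  unfolding vector_def by simp_all

lemma levi_civita_1234: "levi_civita 1 2 3 4 = 1"
proof -
  have "(\<lambda>n::4. (vector [1, 2, 3, 4] :: 4^4) $ n) = id"
  proof
    fix n :: 4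
    show "(vector [1, 2, 3, 4] :: 4^4) $ n = id n"
      using exhaust_4[of n] by (auto simp del: One_nat_def)
  qed
  then show ?thesis by (simp add: levi_civita_def)
qed

lemma
  shows levi_civita_swap12: "levi_civita j i k l = - levi_civita i j k l"
    and levi_civita_swap23: "levi_civita i k j l = - levi_civita i j k l"
    and levi_civita_swap34: "levi_civita i j l k = - levi_civita i j k l"
proof -
  let ?v = "\<lambda>i j k l. (\<lambda>n::4. (vector [i, j, k, l] :: 4^4) $ n)"
  have perm: "permutation (?v i j k l)" if "distinct [i, j, k, l]" for i j k l :: 4
  proof -
    have "inj (?v i j k l)"
    proof (rule injI)
      fix a b :: 4
      assume "?v i j k l a = ?v i j k l b"
      then show "a = b" using that exhaust_4[of a] exhaust_4[of b] by auto
    qed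
    then show ?thesis
      by (simp add: permutation finite_UNIV_inj_surj bij_def)
  qed
  have comp: "?v j i k l = ?v i j k l \<circ> Transposition.transpose 1 2"
             "?v i k j l = ?v i j k l \<circ> Transposition.transpose 2 3"
             "?v i j l k = ?v i j k l \<circ> Transposition.transpose 3 4" for i j k l :: 4
  proof -
    show "?v j i k l = ?v i j k l \<circ> Transposition.transpose 1 2"
    proof
      fix n :: 4 show "?v j i k l n = (?v i j k l \<circ> Transposition.transpose 1 2) n"
        using exhaust_4[of n] by (auto simp: Transposition.transpose_def)
    qed
    show "?v i k j l = ?v i j k l \<circ> Transposition.transpose 2 3"
    proof
      fix n :: 4 show "?v i k j l n = (?v i j k l \<circ> Transposition.transpose 2 3) n"
        using exhaust_4[of n] by (auto simp: Transposition.transpose_def)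
    qed
    show "?v i j l k = ?v i j k l \<circ> Transposition.transpose 3 4"
    proof
      fix n :: 4 show "?v i j l k n = (?v i j k l \<circ> Transposition.transpose 3 4) n"
        using exhaust_4[of n] by (auto simp: Transposition.transpose_def)
    qed
  qed
  have sgn: "sign (g \<circ> Transposition.transpose a b) = - sign g" if "permutation g" "a \<noteq> b" for g and a b :: 4
    using that by (simp add: sign_compose permutation_swap_id sign_swap_id)
  show "levi_civita j i k l = - levi_civita i j k l"
    using perm[of i j k l] by (auto simp: levi_civita_def o_def comp(1)[of j i k l] sgn[unfolded o_def])
  show "levi_civita i k j l = - levi_civita i j k l"
    using perm[of i j k l] by (auto simp: levi_civita_def o_def comp(2)[of i k j l] sgn[unfolded o_def])
  show "levi_civita i j l k = - levi_civita i j k l"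
    using perm[of i j k l] by (auto simp: levi_civita_def o_def comp(3)[of i j l k] sgn[unfolded o_def])
qed

end

theory Submission
  imports Defs
begin

text \<open>
  On pairs of bivectors, \<open>a \<and> b, c \<and> d \<mapsto> det|a, b, c, d|\<close> is a symmetric bilinear form
  preserved by the Hodge star. Differentiating \<open>f \<and> f\<^sub>x = \<star>(\<nu> \<and> \<nu>\<^sub>x)\<close> twice in \<open>x\<close> gives
  \<open>f\<^sub>x \<and> f\<^sub>x\<^sub>x + f \<and> f\<^sub>x\<^sub>x\<^sub>x = \<star>(\<nu>\<^sub>x \<and> \<nu>\<^sub>x\<^sub>x + \<nu> \<and> \<nu>\<^sub>x\<^sub>x\<^sub>x)\<close>, and the form evaluated on the square of
  the left-hand side is \<open>2 det|f, f\<^sub>x, f\<^sub>x\<^sub>x, f\<^sub>x\<^sub>x\<^sub>x|\<close>; in \<open>y\<close> the sign of the equation squares away.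
  Differentiating the first equation in \<open>y\<close> and the second in \<open>x\<close>, the sum and the difference are
  \<open>f \<and> f\<^sub>x\<^sub>y = - \<star>(\<nu>\<^sub>x \<and> \<nu>\<^sub>y)\<close> and \<open>f\<^sub>x \<and> f\<^sub>y = - \<star>(\<nu> \<and> \<nu>\<^sub>x\<^sub>y)\<close>, whose pairing is the mixed identity.
\<close>

section \<open>Derivatives in a fixed direction and their symmetry\<close>

text \<open>With the direction as first argument this is an operator on functions that can be
  iterated, and both partial derivatives become instances of it.\<close>

definition dir_deriv :: "'a::real_normed_vector \<Rightarrow> ('a \<Rightarrow> 'b::real_normed_vector) \<Rightarrow> 'a \<Rightarrow> 'b" where
  "dir_deriv v f x = frechet_derivative f (at x) v"

lemma smooth_on_dir_deriv: "smooth_on S f \<Longrightarrow> smooth_on S (dir_deriv v f)"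
  unfolding smooth_on_def dir_deriv_def by (metis C_n_on.simps(2))

lemma smooth_on_has_derivative:
  "smooth_on S f \<Longrightarrow> x \<in> S \<Longrightarrow> (f has_derivative (\<lambda>v. dir_deriv v f x)) (at x)"
  unfolding smooth_on_def dir_deriv_def
  by (metis C_n_on.simps(2) frechet_derivative_works)

lemma smooth_on_isCont: "smooth_on S f \<Longrightarrow> x \<in> S \<Longrightarrow> isCont f x"
  using has_derivative_continuous smooth_on_has_derivative by blast

lemma dir_deriv_along:
  assumes "smooth_on S f" "(c has_vector_derivative v) (at t)" "c t \<in> S"
  shows "((\<lambda>u. f (c u)) has_vector_derivative dir_deriv v f (c t)) (at t)"
  using vector_derivative_diff_chain_within[OF assms(2), of f]
    smooth_on_has_derivative[OF assms(1,3)]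
  by (auto simp: o_def intro: has_derivative_at_withinI)

lemma partial_eq_dir_deriv:
  assumes "smooth_on S f" "p \<in> S"
  shows "partial_x f p = dir_deriv (1, 0) f p" "partial_y f p = dir_deriv (0, 1) f p"
proof -
  have "((\<lambda>t. (t, snd p)) has_vector_derivative (1, 0)) (at (fst p))"
       "((\<lambda>t. (fst p, t)) has_vector_derivative (0, 1)) (at (snd p))"
    by (auto intro!: has_vector_derivative_Pair derivative_eq_intros)
  from this[THEN dir_deriv_along[OF assms(1)]]
  show "partial_x f p = dir_deriv (1, 0) f p" "partial_y f p = dir_deriv (0, 1) f p"
    using assms(2) by (auto simp: partial_x_def partial_y_def intro: vector_derivative_at)
qed

text \<open>An inner partial derivative is known to agree with \<open>dir_deriv\<close> only on the
  open set; this allows the replacement under an outer partial derivative.\<close>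

lemma partial_cong:
  assumes "open S" "p \<in> S" "\<And>q. q \<in> S \<Longrightarrow> f q = g q"
  shows "partial_x f p = partial_x g p" "partial_y f p = partial_y g p"
proof -
  have "\<forall>\<^sub>F q in nhds p. f q = g q"
    using assms eventually_nhds by blast
  then have ev: "\<forall>\<^sub>F q in nhds (fst p, snd p). f q = g q" by simp
  have "((\<lambda>t. (t, snd p)) \<longlongrightarrow> (fst p, snd p)) (nhds (fst p))"
    "((\<lambda>t. (fst p, t)) \<longlongrightarrow> (fst p, snd p)) (nhds (snd p))"
    by (intro tendsto_Pair tendsto_const filterlim_ident)+
  from this[THEN filterlim_iff[THEN iffD1], rule_format, OF ev]
  show "partial_x f p = partial_x g p" "partial_y f p = partial_y g p"
    by (auto simp: partial_x_def partial_y_def intro!: vector_derivative_cong_eq)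
qed

text \<open>The second difference of \<open>f\<close> over a small parallelogram is evaluated by the
  mean value theorem in both orders, and continuity of the second derivatives closes the gap.
  Components are taken because the mean value theorem is for real functions.\<close>

lemma dir_deriv_commute:
  fixes f :: "'a::real_normed_vector \<Rightarrow> 'b::euclidean_space"
  assumes "open S" "smooth_on S f" "x \<in> S"
  shows "dir_deriv v (dir_deriv w f) x = dir_deriv w (dir_deriv v f) x"
proof (rule euclidean_eqI)
  fix i :: 'b assume "i \<in> Basis"
  let ?vw = "\<lambda>z. dir_deriv v (dir_deriv w f) z \<bullet> i"
  let ?wv = "\<lambda>z. dir_deriv w (dir_deriv v f) z \<bullet> i"
  note sm = assms(2) smooth_on_dir_deriv[OF assms(2)] smooth_on_dir_deriv[OF smooth_on_dir_deriv[OF assms(2)]]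
  have "\<bar>?vw x - ?wv x\<bar> \<le> e" if "e > 0" for e
  proof -
    have "isCont ?vw x" "isCont ?wv x"
      by (auto intro!: continuous_intros smooth_on_isCont[OF sm(3) assms(3)])
    then have "(?vw \<longlongrightarrow> ?vw x) (nhds x)" "(?wv \<longlongrightarrow> ?wv x) (nhds x)"
      using tendsto_at_iff_tendsto_nhds[of ?vw x] tendsto_at_iff_tendsto_nhds[of ?wv x]
      by (simp_all only: isCont_def)
    then have "\<forall>\<^sub>F z in nhds x. dist (?vw z) (?vw x) < e/2" "\<forall>\<^sub>F z in nhds x. dist (?wv z) (?wv x) < e/2"
      using \<open>e > 0\<close> half_gt_zero tendstoD by blast+
    then have "\<forall>\<^sub>F z in nhds x. z \<in> S \<and> dist (?vw z) (?vw x) < e/2 \<and> dist (?wv z) (?wv x) < e/2"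
      using eventually_nhds_in_open[OF assms(1,3)] by eventually_elim auto
    then obtain d where "d > 0" and d: "\<And>z. dist z x < d \<Longrightarrow>
        z \<in> S \<and> dist (?vw z) (?vw x) < e/2 \<and> dist (?wv z) (?wv x) < e/2"
      unfolding eventually_nhds_metric by blast
    \<comment> \<open>Keeps the parallelogram with sides \<open>h *\<^sub>R v\<close> and
      \<open>h *\<^sub>R w\<close> within distance \<open>d\<close> of \<open>x\<close>; the
      \<open>+ 1\<close> covers the case that both directions vanish.\<close>
    define h where "h = d / (norm v + norm w + 1)"
    have pos: "norm v + norm w + 1 > 0" by (simp add: add_nonneg_pos)
    have "h > 0" using \<open>d > 0\<close> pos by (simp add: h_def)
    define c where "c s t = x + s *\<^sub>R v + t *\<^sub>R w" for s t
    have near: "dist (c s t) x < d" if "0 \<le> s" "s \<le> h" "0 \<le> t" "t \<le> h" for s t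
    proof -
      have "dist (c s t) x \<le> norm (s *\<^sub>R v) + norm (t *\<^sub>R w)"
        using norm_triangle_ineq[of "s *\<^sub>R v" "t *\<^sub>R w"] by (simp add: c_def dist_norm add.assoc)
      also have "\<dots> \<le> h * norm v + h * norm w"
        using that by (auto intro!: add_mono mult_right_mono)
      also have "\<dots> < h * (norm v + norm w + 1)"
        using \<open>h > 0\<close> by (simp add: algebra_simps)
      also have "\<dots> = d" using pos by (simp add: h_def)
      finally show ?thesis .
    qed
    note inS = near[THEN d, THEN conjunct1]
    have ds: "((\<lambda>s. g (c s t) \<bullet> i) has_real_derivative dir_deriv v g (c s t) \<bullet> i) (at s)"
      and dt: "((\<lambda>t. g (c s t) \<bullet> i) has_real_derivative dir_deriv w g (c s t) \<bullet> i) (at t)"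
      if "smooth_on S g" "0 \<le> s" "s \<le> h" "0 \<le> t" "t \<le> h" for g :: "'a \<Rightarrow> 'b" and s t
    proof -
      have "((\<lambda>s. c s t) has_vector_derivative v) (at s)" "((\<lambda>t. c s t) has_vector_derivative w) (at t)"
        unfolding c_def by (auto intro!: derivative_eq_intros)
      from this[THEN dir_deriv_along[OF that(1)], OF inS[OF that(2-)],
          THEN bounded_linear.has_vector_derivative[OF bounded_linear_inner_left]]
      show "((\<lambda>s. g (c s t) \<bullet> i) has_real_derivative dir_deriv v g (c s t) \<bullet> i) (at s)"
        "((\<lambda>t. g (c s t) \<bullet> i) has_real_derivative dir_deriv w g (c s t) \<bullet> i) (at t)"
        by (auto simp: has_real_derivative_iff_has_vector_derivative)
    qed
    let ?\<Delta> = "(f (c h h) \<bullet> i - f (c h 0) \<bullet> i) - (f (c 0 h) \<bullet> i - f (c 0 0) \<bullet> i)"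
    have "((\<lambda>s. f (c s h) \<bullet> i - f (c s 0) \<bullet> i) has_real_derivative
        dir_deriv v f (c s h) \<bullet> i - dir_deriv v f (c s 0) \<bullet> i) (at s)" if "0 \<le> s" "s \<le> h" for s
      using that \<open>h > 0\<close> by (intro DERIV_diff ds[OF sm(1)]) auto
    from MVT2[OF \<open>h > 0\<close> this] obtain s where s: "0 < s" "s < h"
      "?\<Delta> = h * (dir_deriv v f (c s h) \<bullet> i - dir_deriv v f (c s 0) \<bullet> i)"
      by auto
    obtain t where t: "0 < t" "t < h"
      "dir_deriv v f (c s h) \<bullet> i - dir_deriv v f (c s 0) \<bullet> i = h * ?wv (c s t)"
      using MVT2[OF \<open>h > 0\<close>, of "\<lambda>t. dir_deriv v f (c s t) \<bullet> i" "\<lambda>t. ?wv (c s t)"]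
        dt[OF sm(2)] \<open>h > 0\<close> s by auto
    \<comment> \<open>The same second difference, regrouped so that the mean value theorem is
      applied first along \<open>w\<close> and then along \<open>v\<close>.\<close>
    have "((\<lambda>t. f (c h t) \<bullet> i - f (c 0 t) \<bullet> i) has_real_derivative
        dir_deriv w f (c h t) \<bullet> i - dir_deriv w f (c 0 t) \<bullet> i) (at t)" if "0 \<le> t" "t \<le> h" for t
      using that \<open>h > 0\<close> by (intro DERIV_diff dt[OF sm(1)]) auto
    from MVT2[OF \<open>h > 0\<close> this] obtain t' where t': "0 < t'" "t' < h"
      "(f (c h h) \<bullet> i - f (c 0 h) \<bullet> i) - (f (c h 0) \<bullet> i - f (c 0 0) \<bullet> i)
        = h * (dir_deriv w f (c h t') \<bullet> i - dir_deriv w f (c 0 t') \<bullet> i)"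
      by auto
    obtain s' where s': "0 < s'" "s' < h"
      "dir_deriv w f (c h t') \<bullet> i - dir_deriv w f (c 0 t') \<bullet> i = h * ?vw (c s' t')"
      using MVT2[OF \<open>h > 0\<close>, of "\<lambda>s. dir_deriv w f (c s t') \<bullet> i" "\<lambda>s. ?vw (c s t')"]
        ds[OF sm(2)] \<open>h > 0\<close> t' by auto
    have "h * (h * ?wv (c s t)) = h * (h * ?vw (c s' t'))"
      using s(3) t'(3) unfolding t(3) s'(3) by linarith
    then have "?wv (c s t) = ?vw (c s' t')" using \<open>h > 0\<close> by simp
    moreover have "dist (?wv (c s t)) (?wv x) < e/2" "dist (?vw (c s' t')) (?vw x) < e/2"
      using d[OF near] s t s' t' by (auto simp: less_imp_le)
    ultimately show ?thesis unfolding dist_real_def by linarith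
  qed
  then show "?vw x = ?wv x"
    using field_le_epsilon[of "\<bar>?vw x - ?wv x\<bar>" 0] by auto
qed

section \<open>Bivectors, the Hodge star and the determinant\<close>

text \<open>Grouped by complementary 2 by 2 minors, so that each factor is an entry of the wedge of
  two rows.\<close>

lemma det_4:
  "det (A::'a::comm_ring_1^4^4) =
     (A$1$1 * A$2$2 - A$1$2 * A$2$1) * (A$3$3 * A$4$4 - A$3$4 * A$4$3)
   - (A$1$1 * A$2$3 - A$1$3 * A$2$1) * (A$3$2 * A$4$4 - A$3$4 * A$4$2)
   + (A$1$1 * A$2$4 - A$1$4 * A$2$1) * (A$3$2 * A$4$3 - A$3$3 * A$4$2)
   + (A$1$2 * A$2$3 - A$1$3 * A$2$2) * (A$3$1 * A$4$4 - A$3$4 * A$4$1)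
   - (A$1$2 * A$2$4 - A$1$4 * A$2$2) * (A$3$1 * A$4$3 - A$3$3 * A$4$1)
   + (A$1$3 * A$2$4 - A$1$4 * A$2$3) * (A$3$1 * A$4$2 - A$3$2 * A$4$1)"
proof -
  have f123: "finite {2::4, 3, 4}" "1 \<notin> {2::4, 3, 4}" by auto
  have f23: "finite {3::4, 4}" "2 \<notin> {3::4, 4}" by auto
  have f3: "finite {4::4}" "3 \<notin> {4::4}" by auto
  show ?thesis
    unfolding det_def UNIV_4
    unfolding sum_over_permutations_insert[OF f123]
    unfolding sum_over_permutations_insert[OF f23]
    unfolding sum_over_permutations_insert[OF f3]
    unfolding permutes_sing
    by (simp add: sign_swap_id permutation_swap_id sign_compose sign_id permutation_compose swap_id_eq algebra_simps)
qed

text \<open>The bilinear form on bivectors, from the Laplace expansion of \<open>det\<close> along the first two rows.\<close>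

definition pairing :: "real^4^4 \<Rightarrow> real^4^4 \<Rightarrow> real" where
  "pairing A B = A$1$2 * B$3$4 - A$1$3 * B$2$4 + A$1$4 * B$2$3
               + A$2$3 * B$1$4 - A$2$4 * B$1$3 + A$3$4 * B$1$2"

lemma det4_pairing: "det4 a b c d = pairing (wedge a b) (wedge c d)"
  by (simp add: det4_def det_4 pairing_def wedge_def algebra_simps)

text \<open>Oriented as rewrite rules that sort the indices, so that simplification terminates.\<close>

lemmas levi_civita_sort =
  levi_civita_swap12[of 2 1] levi_civita_swap12[of 3 1] levi_civita_swap12[of 4 1] levi_civita_swap12[of 3 2] levi_civita_swap12[of 4 2] levi_civita_swap12[of 4 3]
  levi_civita_swap23[of _ 2 1] levi_civita_swap23[of _ 3 1] levi_civita_swap23[of _ 4 1] levi_civita_swap23[of _ 3 2] levi_civita_swap23[of _ 4 2] levi_civita_swap23[of _ 4 3]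
  levi_civita_swap34[of _ _ 2 1] levi_civita_swap34[of _ _ 3 1] levi_civita_swap34[of _ _ 4 1] levi_civita_swap34[of _ _ 3 2] levi_civita_swap34[of _ _ 4 2] levi_civita_swap34[of _ _ 4 3]

lemma levi_civita_eq_0: "\<not> distinct [i, j, k, l] \<Longrightarrow> levi_civita i j k l = 0"
  by (simp only: levi_civita_def if_False)

text \<open>By skew symmetry the index pairs \<open>(l, m)\<close> and \<open>(m, l)\<close>
  contribute equally, which cancels the factor \<open>1/2\<close> and leaves the complementary entry
  up to sign.\<close>

lemma hodge_star_components:
  assumes "\<And>i k. T $ k $ i = - T $ i $ k"
  shows "hodge_star T $ 1 $ 2 = T $ 3 $ 4" "hodge_star T $ 1 $ 3 = - T $ 2 $ 4"
    "hodge_star T $ 1 $ 4 = T $ 2 $ 3" "hodge_star T $ 2 $ 3 = T $ 1 $ 4"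
    "hodge_star T $ 2 $ 4 = - T $ 1 $ 3" "hodge_star T $ 3 $ 4 = T $ 1 $ 2"
  using assms[of 2 1] assms[of 3 1] assms[of 4 1] assms[of 3 2] assms[of 4 2] assms[of 4 3]
  by (simp_all add: hodge_star_def sum_4 levi_civita_eq_0 levi_civita_1234 levi_civita_sort)

lemma bounded_bilinear_wedge: "bounded_bilinear wedge"
  by (auto simp: bilinear_conv_bounded_bilinear[symmetric] bilinear_def wedge_def vec_eq_iff
      algebra_simps intro!: linearI)

lemma bounded_linear_hodge_star: "bounded_linear hodge_star"
  by (auto simp: linear_conv_bounded_linear[symmetric] hodge_star_def vec_eq_iff
      algebra_simps sum.distrib sum_distrib_left intro!: linearI)

lemma wedge_commute: "wedge b a = - wedge a b"
  by (simp add: wedge_def vec_eq_iff)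

lemma wedge_self: "wedge a a = 0"
  by (simp add: wedge_def vec_eq_iff)

text \<open>The star exchanges complementary entries with a common sign, so it only permutes the six
  terms of the form.\<close>

lemma pairing_hodge_star:
  assumes "\<And>i k. A $ k $ i = - A $ i $ k" "\<And>i k. B $ k $ i = - B $ i $ k"
  shows "pairing (hodge_star A) (hodge_star B) = pairing A B"
  by (simp add: pairing_def hodge_star_components[of A, OF assms(1)]
      hodge_star_components[of B, OF assms(2)])

text \<open>Each wedge pairs to zero with itself and the two cross terms agree; moving
  \<open>c\<close> to the front is an even permutation.\<close>

lemma pairing_wedge_add_self:
  "pairing (wedge a b + wedge c d) (wedge a b + wedge c d) = 2 * det4 c a b d"
  by (simp add: det4_def det_4 pairing_def wedge_def algebra_simps)

section \<open>Differentiating the Lelieuvre equations\<close>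

text \<open>The product rule on both sides and uniqueness of the derivative. The scalar
  \<open>c\<close> carries the sign of either equation, and four independent functions allow a
  second application to the differentiated equation.\<close>

lemma dir_deriv_wedge_eq_hodge_star:
  fixes f g \<mu> \<nu> :: "'a::real_normed_vector \<Rightarrow> real^4"
  assumes "open S" "x \<in> S" and sm: "smooth_on S f" "smooth_on S g" "smooth_on S \<mu>" "smooth_on S \<nu>"
    and eq: "\<And>y. y \<in> S \<Longrightarrow> wedge (f y) (g y) = c *\<^sub>R hodge_star (wedge (\<mu> y) (\<nu> y))"
  shows "wedge (f x) (dir_deriv v g x) + wedge (dir_deriv v f x) (g x) =
    c *\<^sub>R hodge_star (wedge (\<mu> x) (dir_deriv v \<nu> x) + wedge (dir_deriv v \<mu> x) (\<nu> x))"
proof -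
  note D = smooth_on_has_derivative[OF _ assms(2)]
  note bl = bounded_linear_compose[OF bounded_linear_scaleR_right bounded_linear_hodge_star]
  have 1: "((\<lambda>y. wedge (f y) (g y)) has_derivative
      (\<lambda>v. wedge (f x) (dir_deriv v g x) + wedge (dir_deriv v f x) (g x))) (at x)"
    by (intro bounded_bilinear.FDERIV[OF bounded_bilinear_wedge] D sm)
  have 2: "((\<lambda>y. c *\<^sub>R hodge_star (wedge (\<mu> y) (\<nu> y))) has_derivative
      (\<lambda>v. c *\<^sub>R hodge_star (wedge (\<mu> x) (dir_deriv v \<nu> x) + wedge (dir_deriv v \<mu> x) (\<nu> x)))) (at x)"
    by (intro bounded_linear.has_derivative[OF bl] bounded_bilinear.FDERIV[OF bounded_bilinear_wedge] D sm)
  from has_derivative_unique[OF has_derivative_transform_within_open[OF 1 assms(1,2) eq] 2]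
  show ?thesis by (rule fun_cong)
qed

lemma det4_third_derivatives:
  fixes f \<nu> :: "'a::real_normed_vector \<Rightarrow> real^4"
  assumes "open S" "x \<in> S" and f: "smooth_on S f" and n: "smooth_on S \<nu>"
    and eq: "\<And>y. y \<in> S \<Longrightarrow> wedge (f y) (dir_deriv v f y) = c *\<^sub>R hodge_star (wedge (\<nu> y) (dir_deriv v \<nu> y))"
    and "c\<^sup>2 = 1"
  defines "D \<equiv> dir_deriv v"
  shows "det4 (f x) (D f x) (D (D f) x) (D (D (D f)) x) = det4 (\<nu> x) (D \<nu> x) (D (D \<nu>) x) (D (D (D \<nu>)) x)"
proof -
  note sf = f smooth_on_dir_deriv[OF f, of v]
  note sn = n smooth_on_dir_deriv[OF n, of v]
  \<comment> \<open>The other product rule term is a wedge of a vector with itself, so the equation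
    keeps its shape on all of \<open>S\<close> and can be differentiated again.\<close>
  have "wedge (f y) (D (D f) y) = c *\<^sub>R hodge_star (wedge (\<nu> y) (D (D \<nu>) y))" if "y \<in> S" for y
    using dir_deriv_wedge_eq_hodge_star[OF assms(1) that sf sn eq, of v] by (simp add: D_def wedge_self)
  from dir_deriv_wedge_eq_hodge_star[OF assms(1,2) f _ n _ this, of v]
  have "wedge (f x) (D (D (D f)) x) + wedge (D f x) (D (D f) x) =
    c *\<^sub>R hodge_star (wedge (\<nu> x) (D (D (D \<nu>)) x) + wedge (D \<nu> x) (D (D \<nu>) x))" (is "?A = c *\<^sub>R hodge_star ?B")
    using sf sn by (simp add: D_def smooth_on_dir_deriv)
  then have "pairing ?A ?A = c\<^sup>2 * pairing (hodge_star ?B) (hodge_star ?B)"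
    by (simp add: pairing_def power2_eq_square algebra_simps)
  also have "\<dots> = pairing ?B ?B"
    using \<open>c\<^sup>2 = 1\<close> by (subst pairing_hodge_star) (simp_all add: wedge_def)
  finally have "det4 (D f x) (f x) (D (D (D f)) x) (D (D f) x) = det4 (D \<nu> x) (\<nu> x) (D (D (D \<nu>)) x) (D (D \<nu>) x)"
    unfolding pairing_wedge_add_self by simp
  \<comment> \<open>Both sides differ from the claim by the same two transpositions, whose signs
    cancel.\<close>
  then show ?thesis
    by (simp add: det4_def det_4 algebra_simps)
qed

lemma det4_mixed_derivatives:
  fixes f \<nu> :: "'a::real_normed_vector \<Rightarrow> real^4"
  assumes "open S" "x \<in> S" and f: "smooth_on S f" and n: "smooth_on S \<nu>"
    and eqv: "\<And>y. y \<in> S \<Longrightarrow> wedge (f y) (dir_deriv v f y) = hodge_star (wedge (\<nu> y) (dir_deriv v \<nu> y))"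
    and eqw: "\<And>y. y \<in> S \<Longrightarrow> wedge (f y) (dir_deriv w f y) = - hodge_star (wedge (\<nu> y) (dir_deriv w \<nu> y))"
  shows "det4 (f x) (dir_deriv v f x) (dir_deriv w f x) (dir_deriv w (dir_deriv v f) x) =
    det4 (\<nu> x) (dir_deriv v \<nu> x) (dir_deriv w \<nu> x) (dir_deriv w (dir_deriv v \<nu>) x)"
proof -
  interpret H: bounded_linear hodge_star by (rule bounded_linear_hodge_star)
  define f1 f2 f12 n1 n2 n12 where fs:
    "f1 = dir_deriv v f x" "f2 = dir_deriv w f x" "f12 = dir_deriv w (dir_deriv v f) x"
    "n1 = dir_deriv v \<nu> x" "n2 = dir_deriv w \<nu> x" "n12 = dir_deriv w (dir_deriv v \<nu>) x"
  have "wedge (f x) f12 + wedge f2 f1 = hodge_star (wedge (\<nu> x) n12 + wedge n2 n1)"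
    using dir_deriv_wedge_eq_hodge_star[OF assms(1,2) f smooth_on_dir_deriv[OF f, of v]
      n smooth_on_dir_deriv[OF n, of v], where c = 1 and v = w] eqv by (simp add: fs)
  then have 1: "wedge (f x) f12 - wedge f1 f2 = hodge_star (wedge (\<nu> x) n12 - wedge n1 n2)"
    by (simp add: wedge_commute[of f2] wedge_commute[of n2])
  \<comment> \<open>Here the mixed derivatives arise in the opposite order, and symmetry turns them
    into \<open>f12\<close> and \<open>n12\<close>.\<close>
  have 2: "wedge (f x) f12 + wedge f1 f2 = - hodge_star (wedge (\<nu> x) n12 + wedge n1 n2)"
    using dir_deriv_wedge_eq_hodge_star[OF assms(1,2) f smooth_on_dir_deriv[OF f, of w]
      n smooth_on_dir_deriv[OF n, of w], where c = "-1" and v = v] eqw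
      dir_deriv_commute[OF assms(1) f assms(2), of v w] dir_deriv_commute[OF assms(1) n assms(2), of v w]
    by (simp add: fs)
  have "2 *\<^sub>R wedge (f x) f12 = - (2 *\<^sub>R hodge_star (wedge n1 n2))"
    using arg_cong2[OF 1 2, of "(+)"] by (simp add: H.add H.diff scaleR_2)
  then have a: "wedge (f x) f12 = - hodge_star (wedge n1 n2)"
    by (metis scaleR_minus_right scaleR_cancel_left zero_neq_numeral)
  then have b: "wedge f1 f2 = - hodge_star (wedge (\<nu> x) n12)"
    using 2 by (simp add: H.add)
  have "pairing (wedge (f x) f12) (wedge f1 f2) = pairing (hodge_star (wedge n1 n2)) (hodge_star (wedge (\<nu> x) n12))"
    unfolding a b by (simp add: pairing_def)
  also have "\<dots> = pairing (wedge n1 n2) (wedge (\<nu> x) n12)"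
    by (rule pairing_hodge_star) (simp_all add: wedge_def)
  \<comment> \<open>On each side a cyclic permutation of three vectors, hence an even one, restores
    the order of the claim.\<close>
  finally show ?thesis
    unfolding fs[symmetric] by (simp add: det4_pairing pairing_def wedge_def algebra_simps)
qed

theorem theorem2p2:
  fixes D :: "(real \<times> real) set"
    and f \<nu> :: "real \<times> real \<Rightarrow> real^4"
  assumes "open D"
    and "smooth_on D f" and "smooth_on D \<nu>"
    and "\<forall>p\<in>D. f p \<noteq> 0" and "\<forall>p\<in>D. \<nu> p \<noteq> 0"
    and "\<forall>p\<in>D. f p \<bullet> \<nu> p = 0"
    and "projective_lelieuvre_on D f \<nu>"
  shows "\<forall>p\<in>D.
      det4 (f p) (partial_x f p) (partial_y f p) (partial_y (partial_x f) p) =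
      det4 (\<nu> p) (partial_x \<nu> p) (partial_y \<nu> p) (partial_y (partial_x \<nu>) p) \<and>
      det4 (f p) (partial_x f p) (partial_x (partial_x f) p) (partial_x (partial_x (partial_x f)) p) =
      det4 (\<nu> p) (partial_x \<nu> p) (partial_x (partial_x \<nu>) p) (partial_x (partial_x (partial_x \<nu>)) p) \<and>
      det4 (f p) (partial_y f p) (partial_y (partial_y f) p) (partial_y (partial_y (partial_y f)) p) =
      det4 (\<nu> p) (partial_y \<nu> p) (partial_y (partial_y \<nu>) p) (partial_y (partial_y (partial_y \<nu>)) p)"
proof
  fix p assume p: "p \<in> D"
  let ?X = "dir_deriv (1, 0)" and ?Y = "dir_deriv (0, 1)"
  have eqs: "wedge (f q) (?X f q) = hodge_star (wedge (\<nu> q) (?X \<nu> q))"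
    "wedge (f q) (?Y f q) = - hodge_star (wedge (\<nu> q) (?Y \<nu> q))" if "q \<in> D" for q
    using assms(7) that
    by (simp_all add: projective_lelieuvre_on_def partial_eq_dir_deriv[OF assms(2)] partial_eq_dir_deriv[OF assms(3)])
  \<comment> \<open>Proved level by level: each order is needed on all of \<open>D\<close> before
    \<open>partial_cong\<close> can pass to the next.\<close>
  have partials: "partial_x g q = ?X g q" "partial_y g q = ?Y g q"
    "partial_y (partial_x g) q = ?Y (?X g) q"
    "partial_x (partial_x g) q = ?X (?X g) q" "partial_y (partial_y g) q = ?Y (?Y g) q"
    "partial_x (partial_x (partial_x g)) q = ?X (?X (?X g)) q"
    "partial_y (partial_y (partial_y g)) q = ?Y (?Y (?Y g)) q"
    if "smooth_on D g" "q \<in> D" for g :: "real \<times> real \<Rightarrow> real^4" and q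
  proof -
    have g: "smooth_on D (?X g)" "smooth_on D (?Y g)" "smooth_on D (?X (?X g))" "smooth_on D (?Y (?Y g))"
      using that by (simp_all add: smooth_on_dir_deriv)
    note pd = partial_eq_dir_deriv and pc = partial_cong[OF \<open>open D\<close>]
    have first: "partial_x g q = ?X g q" "partial_y g q = ?Y g q" if "q \<in> D" for q
      using pd[OF \<open>smooth_on D g\<close> that] by auto
    have second: "partial_y (partial_x g) q = ?Y (?X g) q"
      "partial_x (partial_x g) q = ?X (?X g) q" "partial_y (partial_y g) q = ?Y (?Y g) q" if "q \<in> D" for q
      using pc[OF that first(1)] pc[OF that first(2)] pd[OF g(1) that] pd[OF g(2) that] by auto
    show "partial_x g q = ?X g q" "partial_y g q = ?Y g q"
      "partial_y (partial_x g) q = ?Y (?X g) q"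
      "partial_x (partial_x g) q = ?X (?X g) q" "partial_y (partial_y g) q = ?Y (?Y g) q"
      using first[OF that(2)] second[OF that(2)] by auto
    show "partial_x (partial_x (partial_x g)) q = ?X (?X (?X g)) q"
      "partial_y (partial_y (partial_y g)) q = ?Y (?Y (?Y g)) q"
      using pc[OF that(2) second(2)] pc[OF that(2) second(3)] pd[OF g(3) that(2)] pd[OF g(4) that(2)] by auto
  qed
  show "det4 (f p) (partial_x f p) (partial_y f p) (partial_y (partial_x f) p) =
      det4 (\<nu> p) (partial_x \<nu> p) (partial_y \<nu> p) (partial_y (partial_x \<nu>) p) \<and>
      det4 (f p) (partial_x f p) (partial_x (partial_x f) p) (partial_x (partial_x (partial_x f)) p) =
      det4 (\<nu> p) (partial_x \<nu> p) (partial_x (partial_x \<nu>) p) (partial_x (partial_x (partial_x \<nu>)) p) \<and>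
      det4 (f p) (partial_y f p) (partial_y (partial_y f) p) (partial_y (partial_y (partial_y f)) p) =
      det4 (\<nu> p) (partial_y \<nu> p) (partial_y (partial_y \<nu>) p) (partial_y (partial_y (partial_y \<nu>)) p)"
    unfolding partials[OF assms(2) p] partials[OF assms(3) p]
    using det4_mixed_derivatives[OF assms(1) p assms(2,3) eqs]
      det4_third_derivatives[OF assms(1) p assms(2,3), of "(1, 0)" 1]
      det4_third_derivatives[OF assms(1) p assms(2,3), of "(0, 1)" "-1"] eqs
    by simp
qed

end
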